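(* Let $G=C_n$ be the cycle graph with $n$ vertices, randomly oriented, and let $a,s,b$ be three distinct vertices of $G$. Then the covariance $P(\{a\to s\}\cap\{s\to b\})-P(a\to s)\cdot P(s\to b)$ of the events $\{a\to s\}$ and $\{s\to b\}$ is at most $-\left(\frac12\right)^{2n}$, with equality if and only if the vertices $a$ and $b$ are both adjacent to $s$.
   Context: A graph is randomly oriented if each edge is independently given one of its two possible directions, each with probability $\frac12$. For vertices $u\ne v$, $\{u\to v\}$ denotes the event that there is a directed path from $u$ to $v$. Since three distinct vertices are considered, $n\ge 3$. *)

theory Defs
  imports "HOL-Probability.Probability" "Graph_Theory.Arc_Walk"
begin

record 'a ugraph =
  uverts :: "'a set"
  uedges :: "'a set set"

definition uadjacent :: "'a ugraph \<Rightarrow> 'a \<Rightarrow> 'a \<Rightarrow> bool" where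
  "uadjacent G u v \<longleftrightarrow> {u, v} \<in> uedges G"

text \<open>This is the cycle on \<open>n\<close> vertices only for \<open>n \<ge> 3\<close>; for smaller \<open>n\<close> it has
  a loop or too few edges.\<close>

definition cycle_graph :: "nat \<Rightarrow> nat ugraph" where
  "cycle_graph n = \<lparr>uverts = {0..<n}, uedges = (\<lambda>i. {i, (i + 1) mod n}) ` {0..<n}\<rparr>"

text \<open>An orientation maps each edge to an ordered pair of its two endpoints (tail, head). The
  value at sets that are not edges is fixed to \<open>undefined\<close> and is irrelevant.\<close>

definition random_orientation :: "'a ugraph \<Rightarrow> ('a set \<Rightarrow> 'a \<times> 'a) pmf" where
  "random_orientation G = Pi_pmf (uedges G) undefined (\<lambda>e. pmf_of_set {(u, v). {u, v} = e})"

definition oriented :: "'a ugraph \<Rightarrow> ('a set \<Rightarrow> 'a \<times> 'a) \<Rightarrow> ('a, 'a set) pre_digraph" where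
  "oriented G \<omega> = \<lparr>verts = uverts G, arcs = uedges G,
     tail = (\<lambda>e. fst (\<omega> e)), head = (\<lambda>e. snd (\<omega> e))\<rparr>"

definition path_event :: "'a ugraph \<Rightarrow> 'a \<Rightarrow> 'a \<Rightarrow> ('a set \<Rightarrow> 'a \<times> 'a) set" where
  "path_event G u v = {\<omega>. \<exists>p. pre_digraph.apath (oriented G \<omega>) u p v}"

definition event_covariance :: "'b pmf \<Rightarrow> 'b set \<Rightarrow> 'b set \<Rightarrow> real" where
  "event_covariance M A B =
     measure_pmf.prob M (A \<inter> B) - measure_pmf.prob M A * measure_pmf.prob M B"

end

theory Submission
  imports Defs
begin

text \<open>
  The three vertices cut the cycle into three arcs: \<open>X\<close> between \<open>a\<close> and \<open>s\<close>, \<open>Z\<close> between \<open>s\<close> and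
  \<open>b\<close>, and \<open>Y\<close> between \<open>b\<close> and \<open>a\<close>, each avoiding the third vertex, of lengths \<open>x\<close>, \<open>z\<close>, \<open>y\<close> with
  \<open>x + y + z = n\<close>. A directed path in an oriented cycle never turns back, so it runs along one of
  the two arcs joining its ends, and all edges of that arc then point the same way round the cycle
  (\<open>path_event_iff_arc\<close>). Let \<open>d\<close> be the sense of rotation that leads from \<open>a\<close> through \<open>s\<close> to \<open>b\<close>.
  Up to null sets, \<open>a\<close> reaches \<open>s\<close> iff \<open>X\<close> is oriented along \<open>d\<close> or \<open>Y \<union> Z\<close> against it, and \<open>s\<close>
  reaches \<open>b\<close> iff \<open>Z\<close> is oriented along \<open>d\<close> or \<open>X \<union> Y\<close> against it. Prescribing the directions of
  \<open>k\<close> edges has probability \<open>2\<^sup>-\<^sup>k\<close> (\<open>prob_agree\<close>), hence by inclusion-exclusion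
  \<open>P(a \<rightarrow> s) = 2\<^sup>-\<^sup>x + 2\<^sup>-\<^sup>(\<^sup>y\<^sup>+\<^sup>z\<^sup>) - 2\<^sup>-\<^sup>n\<close> and \<open>P(s \<rightarrow> b) = 2\<^sup>-\<^sup>z + 2\<^sup>-\<^sup>(\<^sup>x\<^sup>+\<^sup>y\<^sup>) - 2\<^sup>-\<^sup>n\<close>.

  Both paths exist together only in two disjoint ways: \<open>X \<union> Z\<close> is oriented along \<open>d\<close>, or the whole
  cycle is oriented against it. Every other combination asks for opposite directions on \<open>X\<close> or on
  \<open>Z\<close>. The joint probability is therefore \<open>2\<^sup>-\<^sup>(\<^sup>x\<^sup>+\<^sup>z\<^sup>) + 2\<^sup>-\<^sup>n\<close> (\<open>covariance_arc_events\<close>).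

  It remains to see why the resulting expression has the stated bound. Writing
  \<open>p = 2\<^sup>-\<^sup>x\<close>, \<open>q = 2\<^sup>-\<^sup>y\<close>, \<open>r = 2\<^sup>-\<^sup>z\<close>, the covariance plus \<open>2\<^sup>-\<^sup>2\<^sup>n\<close> equals
  \<open>q (p r (p + r - 1) (1 + q) - (p - r)\<^sup>2)\<close>. Since \<open>p\<close> and \<open>r\<close> are at most \<open>1/2\<close>, this is not
  positive, and it vanishes exactly for \<open>p = r = 1/2\<close>, that is, when \<open>X\<close> and \<open>Z\<close> are single edges
  (\<open>cycle_covariance_bound\<close>).
\<close>

section \<open>Edges of the cycle and prescribed directions\<close>

text \<open>
  The edge \<open>{i, i + 1}\<close> is named by its index \<open>i\<close>. The flag \<open>d\<close> tells whether it points in the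
  sense of increasing indices, so a direction is a Boolean that can be compared across edges.
\<close>

definition arrow :: "nat \<Rightarrow> bool \<Rightarrow> nat \<Rightarrow> nat \<times> nat" where
  "arrow n d i = (if d then (i, (i + 1) mod n) else ((i + 1) mod n, i))"

definition agree :: "nat \<Rightarrow> (nat \<Rightarrow> bool) \<Rightarrow> nat set \<Rightarrow> (nat set \<Rightarrow> nat \<times> nat) set" where
  "agree n \<sigma> A = {\<omega>. \<forall>i\<in>A. \<omega> {i, (i + 1) mod n} = arrow n (\<sigma> i) i}"

lemma succ_mod: "i < n \<Longrightarrow> (i + 1) mod n = (if i + 1 = n then 0 else i + (1::nat))"
  by auto

lemma succ_mod_neq: "3 \<le> n \<Longrightarrow> i < n \<Longrightarrow> (i + 1) mod n \<noteq> (i::nat)"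
  unfolding succ_mod by auto

text \<open>
  The bound on \<open>n\<close> matters: for \<open>n = 2\<close> the indices 0 and 1 name the same edge.
\<close>

lemma inj_on_cycle_edge:
  assumes "3 \<le> n"
  shows "inj_on (\<lambda>i. {i, (i + 1) mod n}) {0..<(n::nat)}"
proof (rule inj_onI)
  fix i j assume ij: "i \<in> {0..<n}" "j \<in> {0..<n}" and "{i, (i + 1) mod n} = {j, (j + 1) mod n}"
  then have "i = j \<or> i = (j + 1) mod n \<and> j = (i + 1) mod n"
    by (auto simp: doubleton_eq_iff)
  then have "i = j \<or> i = (if j + 1 = n then 0 else j + 1) \<and> j = (if i + 1 = n then 0 else i + 1)"
    using ij by (simp only: succ_mod atLeastLessThan_iff)
  then show "i = j"
    using ij assms by (auto split: if_splits)
qed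

lemma edge_orientations:
  "{(x, y). {x, y} = {i, (i + 1) mod n}} = {arrow n True i, arrow n False i}"
  by (auto simp: arrow_def doubleton_eq_iff)

lemma arrow_inject: "3 \<le> n \<Longrightarrow> i < n \<Longrightarrow> arrow n d i = arrow n d' i \<longleftrightarrow> d = d'"
  using succ_mod_neq[of n i] by (auto simp: arrow_def)

lemma agree_Un: "agree n \<sigma> (A \<union> B) = agree n \<sigma> A \<inter> agree n \<sigma> B"
  by (auto simp: agree_def)

lemma agree_cong: "(\<And>i. i \<in> A \<Longrightarrow> \<sigma> i = \<tau> i) \<Longrightarrow> agree n \<sigma> A = agree n \<tau> A"
  by (simp add: agree_def)

text \<open>
  The edges are oriented independently, so the probability is a product over the edges: each
  prescribed edge contributes one half, every other edge contributes 1.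
\<close>

lemma prob_agree:
  assumes n: "3 \<le> n" and A: "A \<subseteq> {0..<n}"
  shows "measure_pmf.prob (random_orientation (cycle_graph n)) (agree n \<sigma> A) = (1/2) ^ card A"
proof -
  let ?e = "\<lambda>i. {i, (i + 1) mod n}" and ?E = "uedges (cycle_graph n)"
  let ?p = "\<lambda>e. pmf_of_set {(u, v). {u, v} = e} :: (nat \<times> nat) pmf"
  \<comment> \<open>The constraint per edge rather than per index. As distinct indices name distinct edges, it
    admits either one value or all values.\<close>
  define F where "F e = {q. \<forall>i\<in>A. e = ?e i \<longrightarrow> q = arrow n (\<sigma> i) i}" for e
  have E: "?E = ?e ` {0..<n}" by (simp add: cycle_graph_def)
  have inj: "inj_on ?e {0..<n}" by (rule inj_on_cycle_edge[OF n])
  have "agree n \<sigma> A = Pi ?E F"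
    using A by (auto simp: agree_def F_def E Pi_def)
  then have "measure_pmf.prob (random_orientation (cycle_graph n)) (agree n \<sigma> A)
      = (\<Prod>e\<in>?E. measure_pmf.prob (?p e) (F e))"
    by (simp add: random_orientation_def measure_Pi_pmf_Pi E)
  also have "\<dots> = (\<Prod>i\<in>{0..<n}. measure_pmf.prob (?p (?e i)) (F (?e i)))"
    unfolding E by (rule prod.reindex_cong[OF inj]) simp_all
  also have "\<dots> = (\<Prod>i\<in>{0..<n}. if i \<in> A then 1/2 else 1)"
  proof (rule prod.cong[OF refl])
    fix i assume i: "i \<in> {0..<n}"
    have ne: "arrow n True i \<noteq> arrow n False i"
      using arrow_inject[of n i True False] i n by simp
    have p: "?p (?e i) = pmf_of_set {arrow n True i, arrow n False i}"
      unfolding edge_orientations ..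
    have eq: "?e i = ?e j \<longleftrightarrow> i = j" if "j \<in> A" for j
      using inj_on_eq_iff[OF inj] i that A by blast
    show "measure_pmf.prob (?p (?e i)) (F (?e i)) = (if i \<in> A then 1/2 else 1)"
    proof (cases "i \<in> A")
      case True
      have "F (?e i) = {arrow n (\<sigma> i) i}"
        using True eq by (auto simp: F_def)
      moreover have "arrow n (\<sigma> i) i \<in> {arrow n True i, arrow n False i}"
        by (cases "\<sigma> i") auto
      ultimately show ?thesis
        using True ne unfolding p by (simp add: measure_pmf_single)
    next
      case False
      then have "F (?e i) = UNIV"
        using eq by (auto simp: F_def)
      then show ?thesis using False by simp
    qed
  qed
  also have "\<dots> = (1/2) ^ card A"
    using A by (simp add: prod.If_cases Int_absorb1)
  finally show ?thesis .
qed

text \<open>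
  The type of orientations also contains maps whose value at an edge is not a pair of its
  endpoints. They have probability zero, but for them the digraph need not be well formed, so the
  criterion for paths is stated on the support only.
\<close>

lemma random_orientation_valid:
  assumes "\<omega> \<in> set_pmf (random_orientation (cycle_graph n))" "i < n"
  shows "\<exists>d. \<omega> {i, (i + 1) mod n} = arrow n d i"
proof -
  let ?e = "{i, (i + 1) mod n}"
  have "finite (uedges (cycle_graph n))" "?e \<in> uedges (cycle_graph n)"
    using assms(2) by (auto simp: cycle_graph_def)
  then have "\<omega> ?e \<in> set_pmf (pmf_of_set {(u, v). {u, v} = ?e})"
    using assms(1) by (auto simp: random_orientation_def set_Pi_pmf PiE_dflt_def)
  then show ?thesis unfolding edge_orientations by auto
qed

section \<open>Arcs of the cycle\<close>

text \<open>
  The edges passed when walking from \<open>u\<close> to \<open>v\<close> with increasing indices modulo \<open>n\<close>. For \<open>u > v\<close>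
  the walk passes through 0; for \<open>u = v\<close> it is empty rather than a full turn.
\<close>

definition arc_edges :: "nat \<Rightarrow> nat \<Rightarrow> nat \<Rightarrow> nat set" where
  "arc_edges n u v = {i. i < n \<and> (if u \<le> v then u \<le> i \<and> i < v else u \<le> i \<or> i < v)}"

lemma arc_edges_self [simp]: "arc_edges n u u = {}"
  by (auto simp: arc_edges_def)

lemma arc_edges_step:
  assumes "u < n" "v < n" "u \<noteq> v"
  shows "arc_edges n u v = insert u (arc_edges n ((u + 1) mod n) v)"
    and "u \<notin> arc_edges n ((u + 1) mod n) v"
  using assms unfolding succ_mod[OF assms(1)] by (auto simp: arc_edges_def)

lemma arc_edges_snoc:
  assumes "u < n" "w < n" "(w + 1) mod n \<noteq> u"
  shows "arc_edges n u ((w + 1) mod n) = insert w (arc_edges n u w)"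
  using assms unfolding succ_mod[OF assms(2)] by (auto simp: arc_edges_def split: if_splits)

lemma finite_arc_edges [simp]: "finite (arc_edges n u v)"
  by (simp add: arc_edges_def)

text \<open>
  Induction along the arc from \<open>u\<close> to \<open>v\<close>, peeling off its first edge. Read forwards it builds paths
  leaving \<open>u\<close>; with the arc oriented backwards it builds paths arriving at \<open>u\<close>.
\<close>

lemma arc_edges_induct [consumes 2, case_names base step]:
  fixes u v n :: nat
  assumes "u < n" "v < n"
    and base: "P v"
    and step: "\<And>u. u < n \<Longrightarrow> u \<noteq> v \<Longrightarrow> P ((u + 1) mod n) \<Longrightarrow> P u"
  shows "P u"
  using assms(1)
proof (induction "card (arc_edges n u v)" arbitrary: u rule: less_induct)
  case less
  show ?case
  proof (cases "u = v")
    case False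
    have "card (arc_edges n ((u + 1) mod n) v) < card (arc_edges n u v)"
      using arc_edges_step[OF less.prems assms(2) False] by simp
    moreover have "(u + 1) mod n < n" using less.prems by simp
    ultimately have "P ((u + 1) mod n)" by (rule less.hyps)
    then show ?thesis by (rule step[OF less.prems False])
  qed (simp add: base)
qed

section \<open>Directed paths in an oriented cycle\<close>

lemma wf_digraph_oriented_cycle:
  assumes valid: "\<And>i. i < n \<Longrightarrow> \<exists>d. \<omega> {i, (i + 1) mod n} = arrow n d i"
  shows "wf_digraph (oriented (cycle_graph n) \<omega>)" (is "wf_digraph ?G")
proof
  fix e assume "e \<in> arcs ?G"
  then obtain i where i: "i < n" "e = {i, (i + 1) mod n}"
    by (auto simp: oriented_def cycle_graph_def)
  then obtain d where "\<omega> e = arrow n d i" using valid by blast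
  then show "tail ?G e \<in> verts ?G" "head ?G e \<in> verts ?G"
    using i by (auto simp: oriented_def cycle_graph_def arrow_def)
qed

text \<open>
  The right-hand side is an invariant of walks from \<open>u\<close>. Suppose it holds at \<open>w\<close> because the arc from
  \<open>u\<close> up to \<open>w\<close> is directed upwards. An upward step extends that arc. A downward step from \<open>w\<close> would
  use the last edge of the arc, which points upwards, unless \<open>w = u\<close>, where the arc is empty and both
  directions are still open. The other alternative is the mirror image.
\<close>

lemma reachable_iff_arc:
  assumes n: "3 \<le> n" and u: "u < n" and v: "v < n"
    and valid: "\<And>i. i < n \<Longrightarrow> \<exists>d. \<omega> {i, (i + 1) mod n} = arrow n d i"
  shows "u \<rightarrow>\<^sup>*\<^bsub>oriented (cycle_graph n) \<omega>\<^esub> v \<longleftrightarrow>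
    \<omega> \<in> agree n (\<lambda>_. True) (arc_edges n u v) \<union> agree n (\<lambda>_. False) (arc_edges n v u)"
    (is "?reach u v \<longleftrightarrow> ?arc v")
proof -
  let ?G = "oriented (cycle_graph n) \<omega>"
  interpret wf_digraph ?G by (rule wf_digraph_oriented_cycle) (rule valid)
  have dom: "x \<rightarrow>\<^bsub>?G\<^esub> y \<longleftrightarrow> (\<exists>i<n. \<omega> {i, (i + 1) mod n} = (x, y))" for x y
  proof -
    have "arcs_ends ?G = (\<lambda>i. \<omega> {i, (i + 1) mod n}) ` {0..<n}"
      by (simp add: arcs_ends_conv oriented_def cycle_graph_def image_image)
    then have "x \<rightarrow>\<^bsub>?G\<^esub> y \<longleftrightarrow> (\<exists>i<n. (x, y) = \<omega> {i, (i + 1) mod n})"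
      by (simp only: image_iff atLeast0LessThan lessThan_iff Bex_def)
    then show ?thesis by metis
  qed
  have refl: "x < n \<Longrightarrow> ?reach x x" for x
    by (rule reachable_refl) (simp add: oriented_def cycle_graph_def)
  show ?thesis
  proof
    assume "?reach u v"
    then show "?arc v"
    proof (induction rule: reachable_induct)
      case base
      show ?case by (simp add: agree_def)
    next
      case (step w w')
      obtain i d where i: "i < n" "\<omega> {i, (i + 1) mod n} = (w, w')" "arrow n d i = (w, w')"
        using step.hyps(2) dom valid by metis
      have other: "\<omega> {i, (i + 1) mod n} \<noteq> arrow n (\<not> d) i"
        using i arrow_inject[OF n i(1), of d "\<not> d"] by simp
      show ?case
      proof (cases d)
        case True
        then have w: "w = i" "w' = (i + 1) mod n" using i(3) by (auto simp: arrow_def)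
        \<comment> \<open>If only the downward alternative held at \<open>w\<close>, the edge \<open>i\<close> would have both directions.\<close>
        have up: "\<omega> \<in> agree n (\<lambda>_. True) (arc_edges n u i)"
        proof (cases "u = i")
          case False
          then have "i \<in> arc_edges n i u" using arc_edges_step(1)[OF i(1) u] by simp
          then show ?thesis using step.IH other True w by (auto simp: agree_def)
        qed (simp add: agree_def)
        show ?thesis
        \<comment> \<open>If the step returns to \<open>u\<close>, the arc from \<open>u\<close> to \<open>w'\<close> is empty.\<close>
        proof (cases "w' = u")
          case False
          then have "arc_edges n u w' = insert i (arc_edges n u i)"
            using arc_edges_snoc[OF u i(1)] w by simp
          then show ?thesis using up i True by (auto simp: agree_def)
        qed (simp add: agree_def)
      next
        case False
        then have w: "w' = i" "w = (i + 1) mod n" using i(3) by (auto simp: arrow_def)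
        \<comment> \<open>If only the upward alternative held at \<open>w\<close>, the edge \<open>i\<close> would have both directions.\<close>
        have down: "\<omega> \<in> agree n (\<lambda>_. False) (arc_edges n w u)"
        proof (cases "w = u")
          case neq: False
          then have "i \<in> arc_edges n u w" using arc_edges_snoc[OF u i(1)] w by simp
          then show ?thesis using step.IH other False by (auto simp: agree_def)
        qed (simp add: agree_def)
        show ?thesis
        \<comment> \<open>If the step returns to \<open>u\<close>, the arc from \<open>w'\<close> to \<open>u\<close> is empty.\<close>
        proof (cases "i = u")
          case neq: False
          then have "arc_edges n i u = insert i (arc_edges n w u)"
            using arc_edges_step(1)[OF i(1) u] w by simp
          then show ?thesis using down i False w by (auto simp: agree_def)
        qed (simp add: agree_def w)
      qed
    qed
  next
    assume "?arc v"
    then show "?reach u v"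
    proof
      assume "\<omega> \<in> agree n (\<lambda>_. True) (arc_edges n u v)"
      with u v show ?thesis
      proof (induction rule: arc_edges_induct)
        case base
        show ?case by (rule refl[OF v])
      next
        case (step u)
        then have "u \<rightarrow>\<^bsub>?G\<^esub> ((u + 1) mod n)"
          using v unfolding dom by (auto simp: arc_edges_step(1) agree_def arrow_def)
        moreover have "?reach ((u + 1) mod n) v"
          using step v by (simp add: arc_edges_step(1) agree_def)
        ultimately show ?case by (rule adj_reachable_trans)
      qed
    next
      assume "\<omega> \<in> agree n (\<lambda>_. False) (arc_edges n v u)"
      with v u show ?thesis
      proof (induction rule: arc_edges_induct)
        case base
        show ?case by (rule refl[OF u])
      next
        case (step v)
        then have "((v + 1) mod n) \<rightarrow>\<^bsub>?G\<^esub> v"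
          using u unfolding dom by (auto simp: arc_edges_step(1) agree_def arrow_def)
        moreover have "?reach u ((v + 1) mod n)"
          using step u by (simp add: arc_edges_step(1) agree_def)
        ultimately show ?case by (meson reachable_adj_trans)
      qed
    qed
  qed
qed

lemma path_event_iff_arc:
  assumes n: "3 \<le> n" and u: "u < n" and v: "v < n"
    and \<omega>: "\<omega> \<in> set_pmf (random_orientation (cycle_graph n))"
  shows "\<omega> \<in> path_event (cycle_graph n) u v \<longleftrightarrow>
    \<omega> \<in> agree n (\<lambda>_. True) (arc_edges n u v) \<union> agree n (\<lambda>_. False) (arc_edges n v u)"
proof -
  note valid = random_orientation_valid[OF \<omega>]
  interpret wf_digraph "oriented (cycle_graph n) \<omega>" by (rule wf_digraph_oriented_cycle) (rule valid)
  show ?thesis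
    using reachable_iff_arc[OF n u v valid]
    unfolding path_event_def reachable_apath by (simp only: mem_Collect_eq)
qed

section \<open>The covariance as a function of the arc lengths\<close>

text \<open>
  Here \<open>x\<close>, \<open>y\<close>, \<open>z\<close> are the lengths of the three arcs and \<open>C\<close> is the covariance computed from them.
  In terms of \<open>X = h x\<close>, \<open>Y = h y\<close>, \<open>Z = h z\<close> the difference between \<open>C\<close> and the bound is
  \<open>Y (X Z (X + Z - 1) (1 + Y) - (X - Z)\<^sup>2)\<close>. Both summands in the bracket are nonpositive because
  \<open>X + Z \<le> 1\<close>, and the first one vanishes only for \<open>X = Z = 1/2\<close>, where the second vanishes too.
\<close>

lemma cycle_covariance_bound:
  fixes x y z :: nat
  assumes "0 < x" "0 < y" "0 < z"
  defines "h \<equiv> \<lambda>k. (1/2 :: real) ^ k"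
  defines "C \<equiv> h (x + z) + h (x + y + z)
    - (h x + h (y + z) - h (x + y + z)) * (h z + h (x + y) - h (x + y + z))"
  shows "C \<le> - h (2 * (x + y + z))"
    and "C = - h (2 * (x + y + z)) \<longleftrightarrow> x = 1 \<and> z = 1"
proof -
  define X Y Z where "X = h x" and "Y = h y" and "Z = h z"
  have half: "0 < h k \<and> h k \<le> 1/2 \<and> (h k = 1/2 \<longleftrightarrow> k = 1)" if "0 < k" for k
  proof -
    obtain m where m: "k = Suc m" using \<open>0 < k\<close> by (cases k) auto
    have "h m \<le> 1" by (simp add: h_def power_le_one)
    moreover have "h m = 1 \<longleftrightarrow> m = 0"
    proof (cases m)
      case (Suc l)
      then have "h m < 1" unfolding h_def Suc by (intro power_Suc_less_one) auto
      then show ?thesis using Suc by simp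
    qed (simp add: h_def)
    ultimately show ?thesis by (auto simp: m h_def)
  qed
  have X: "0 < X" "X \<le> 1/2" "X = 1/2 \<longleftrightarrow> x = 1" using half[OF assms(1)] by (auto simp: X_def)
  have Z: "0 < Z" "Z \<le> 1/2" "Z = 1/2 \<longleftrightarrow> z = 1" using half[OF assms(3)] by (auto simp: Z_def)
  have Y: "0 < Y" using half[OF assms(2)] by (auto simp: Y_def)
  have h: "h (x + z) = X * Z" "h (x + y) = X * Y" "h (y + z) = Y * Z" "h (x + y + z) = X * Y * Z"
    "h (2 * (x + y + z)) = (X * Y * Z)\<^sup>2"
    by (simp_all add: X_def Y_def Z_def h_def power_add power_mult power2_eq_square mult_2)
  have eq: "C + h (2 * (x + y + z)) = Y * (X * Z * (X + Z - 1) * (1 + Y) - (X - Z)\<^sup>2)"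
    unfolding C_def h X_def[symmetric] Z_def[symmetric] by (simp add: algebra_simps power2_eq_square)
  have le: "X * Z * (X + Z - 1) * (1 + Y) \<le> 0"
    using X Y Z by (intro mult_nonpos_nonneg mult_nonneg_nonpos) auto
  then have "X * Z * (X + Z - 1) * (1 + Y) - (X - Z)\<^sup>2 \<le> 0"
    using zero_le_power2[of "X - Z"] by linarith
  then have "C + h (2 * (x + y + z)) \<le> 0"
    using Y unfolding eq by (simp add: mult_nonneg_nonpos)
  then show "C \<le> - h (2 * (x + y + z))" by linarith
  have "C = - h (2 * (x + y + z)) \<longleftrightarrow> X * Z * (X + Z - 1) * (1 + Y) - (X - Z)\<^sup>2 = 0"
    using eq Y by auto
  also have "\<dots> \<longleftrightarrow> X = 1/2 \<and> Z = 1/2"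
  proof
    assume "X * Z * (X + Z - 1) * (1 + Y) - (X - Z)\<^sup>2 = 0"
    with le have "X * Z * (X + Z - 1) * (1 + Y) = 0"
      using zero_le_power2[of "X - Z"] by linarith
    then show "X = 1/2 \<and> Z = 1/2" using X Y Z by auto
  next
    assume "X = 1/2 \<and> Z = 1/2"
    then have "X + Z - 1 = 0" "X - Z = 0" by linarith+
    then show "X * Z * (X + Z - 1) * (1 + Y) - (X - Z)\<^sup>2 = 0"
      by (simp only: mult_zero_right mult_zero_left) simp
  qed
  finally show "C = - h (2 * (x + y + z)) \<longleftrightarrow> x = 1 \<and> z = 1" using X Z by simp
qed

text \<open>
  The flag \<open>d\<close> covers both cyclic orders in which three vertices can lie: reversing the numbering of
  the cycle exchanges the two senses of rotation and leaves everything else unchanged.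
\<close>

lemma covariance_arc_events:
  fixes d :: bool
  assumes n: "3 \<le> n"
    and part: "X \<union> Y \<union> Z = {0..<n}" "X \<inter> Y = {}" "X \<inter> Z = {}" "Y \<inter> Z = {}"
    and ne: "X \<noteq> {}" "Y \<noteq> {}" "Z \<noteq> {}"
  defines "A \<equiv> agree n (\<lambda>_. d) X \<union> agree n (\<lambda>_. \<not> d) (Y \<union> Z)"
    and "B \<equiv> agree n (\<lambda>_. d) Z \<union> agree n (\<lambda>_. \<not> d) (X \<union> Y)"
    and "M \<equiv> random_orientation (cycle_graph n)"
  shows "event_covariance M A B \<le> - ((1/2) ^ (2 * n))"
    and "event_covariance M A B = - ((1/2) ^ (2 * n)) \<longleftrightarrow> card X = 1 \<and> card Z = 1"
proof -
  define h where "h k = (1/2 :: real) ^ k" for k :: nat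
  have fin: "finite X" "finite Y" "finite Z"
    using part(1) by (metis finite_Un finite_atLeastLessThan)+
  have sub: "X \<subseteq> {0..<n}" "Y \<subseteq> {0..<n}" "Z \<subseteq> {0..<n}" using part(1) by auto
  have pos: "0 < card X" "0 < card Y" "0 < card Z" using fin ne by auto
  have card: "card (Y \<union> Z) = card Y + card Z" "card (X \<union> Y) = card X + card Y"
    "card (X \<union> Z) = card X + card Z"
    using fin part by (simp_all add: card_Un_disjoint)
  have "card (X \<union> Y \<union> Z) = card X + card Y + card Z"
    using fin part card by (subst card_Un_disjoint) auto
  then have cn: "n = card X + card Y + card Z" using part(1) by simp
  have prob: "measure_pmf.prob M (agree n \<sigma> S) = h (card S)" if "S \<subseteq> {0..<n}" for \<sigma> S
    using prob_agree[OF n that] by (simp add: M_def h_def)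
  have prob_all: "measure_pmf.prob M (agree n \<sigma> {0..<n}) = h n" for \<sigma>
    using prob[of "{0..<n}"] by simp
  \<comment> \<open>Opposite prescriptions that share an edge exclude each other.\<close>
  have clash: "agree n (\<lambda>_. d) S \<inter> agree n (\<lambda>_. \<not> d) T = {}"
    if st: "S \<inter> T \<noteq> {}" "S \<subseteq> {0..<n}" for S T
  proof -
    obtain i where i: "i \<in> S" "i \<in> T" using st(1) by blast
    then have "arrow n d i \<noteq> arrow n (\<not> d) i"
      using arrow_inject[OF n, of i d "\<not> d"] st(2) by auto
    then show ?thesis using i by (auto simp: agree_def)
  qed
  \<comment> \<open>Opposite prescriptions on disjoint sets amount to one prescription on the union, so
    \<open>prob_agree\<close> applies.\<close>
  have glue: "agree n (\<lambda>_. d) S \<inter> agree n (\<lambda>_. \<not> d) T = agree n (\<lambda>i. (i \<in> S) = d) (S \<union> T)"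
    if "S \<inter> T = {}" for S T
  proof -
    have "agree n (\<lambda>_. d) S = agree n (\<lambda>i. (i \<in> S) = d) S"
      by (rule agree_cong) simp
    moreover have "agree n (\<lambda>_. \<not> d) T = agree n (\<lambda>i. (i \<in> S) = d) T"
      using that by (intro agree_cong) auto
    ultimately show ?thesis by (simp add: agree_Un)
  qed
  have union: "measure_pmf.prob M (E \<union> F) =
      measure_pmf.prob M E + measure_pmf.prob M F - measure_pmf.prob M (E \<inter> F)" for E F
    by (simp add: measure_Un3 measure_pmf.fmeasurable_eq_sets)
  have "measure_pmf.prob M A = h (card X) + h (card Y + card Z) - h n"
  proof -
    have "X \<inter> (Y \<union> Z) = {}" "X \<union> (Y \<union> Z) = {0..<n}" using part by blast+
    then show ?thesis using sub by (simp add: A_def union glue prob prob_all card)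
  qed
  moreover have "measure_pmf.prob M B = h (card Z) + h (card X + card Y) - h n"
  proof -
    have "Z \<inter> (X \<union> Y) = {}" "Z \<union> (X \<union> Y) = {0..<n}" using part by blast+
    then show ?thesis using sub by (simp add: B_def union glue prob prob_all card)
  qed
  moreover have "measure_pmf.prob M (A \<inter> B) = h (card X + card Z) + h n"
  proof -
    \<comment> \<open>Of the four combinations, the two mixed ones clash on \<open>X\<close> and on \<open>Z\<close> respectively.\<close>
    have "A \<inter> B = agree n (\<lambda>_. d) (X \<union> Z) \<union> agree n (\<lambda>_. \<not> d) {0..<n}"
    proof -
      have "agree n (\<lambda>_. d) X \<inter> agree n (\<lambda>_. \<not> d) (X \<union> Y) = {}"
        "agree n (\<lambda>_. d) Z \<inter> agree n (\<lambda>_. \<not> d) (Y \<union> Z) = {}"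
        using clash[of X "X \<union> Y"] clash[of Z "Y \<union> Z"] ne sub by auto
      moreover have "agree n (\<lambda>_. \<not> d) {0..<n} =
          agree n (\<lambda>_. \<not> d) (Y \<union> Z) \<inter> agree n (\<lambda>_. \<not> d) (X \<union> Y)"
        unfolding agree_Un[symmetric] part(1)[symmetric] by (rule arg_cong[of _ _ "agree n _"]) blast
      ultimately show ?thesis
        unfolding A_def B_def agree_Un[of _ _ X Z] by blast
    qed
    moreover have "agree n (\<lambda>_. d) (X \<union> Z) \<inter> agree n (\<lambda>_. \<not> d) {0..<n} = {}"
      using ne sub by (intro clash) auto
    ultimately show ?thesis
      using sub by (simp add: union prob prob_all card)
  qed
  ultimately have cov: "event_covariance M A B = h (card X + card Z) + h n
      - (h (card X) + h (card Y + card Z) - h n) * (h (card Z) + h (card X + card Y) - h n)"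
    by (simp add: event_covariance_def)
  note bound = cycle_covariance_bound[OF pos, folded cn h_def]
  show "event_covariance M A B \<le> - ((1/2) ^ (2 * n))"
    using bound(1) by (simp add: cov h_def)
  show "event_covariance M A B = - ((1/2) ^ (2 * n)) \<longleftrightarrow> card X = 1 \<and> card Z = 1"
    using bound(2) by (simp add: cov h_def)
qed

text \<open>
  Events that agree on the support have the same covariance, so path events may be replaced by arc
  conditions.
\<close>

lemma covariance_path_events:
  fixes n u v w x :: nat
  assumes n: "3 \<le> n" and lt: "u < n" "v < n" "w < n" "x < n"
  shows "event_covariance (random_orientation (cycle_graph n))
           (path_event (cycle_graph n) u v) (path_event (cycle_graph n) w x) =
         event_covariance (random_orientation (cycle_graph n))
           (agree n (\<lambda>_. True) (arc_edges n u v) \<union> agree n (\<lambda>_. False) (arc_edges n v u))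
           (agree n (\<lambda>_. True) (arc_edges n w x) \<union> agree n (\<lambda>_. False) (arc_edges n x w))"
proof -
  let ?M = "random_orientation (cycle_graph n)"
  have cong: "measure_pmf.prob ?M E = measure_pmf.prob ?M F"
    if "\<And>\<omega>. \<omega> \<in> set_pmf ?M \<Longrightarrow> \<omega> \<in> E \<longleftrightarrow> \<omega> \<in> F" for E F
    using that by (intro measure_prob_cong_0) (auto simp: set_pmf_eq)
  note iff = path_event_iff_arc[OF n lt(1,2)] path_event_iff_arc[OF n lt(3,4)]
  show ?thesis
    unfolding event_covariance_def
    by (intro arg_cong2[of _ _ _ _ "(-)"] arg_cong2[of _ _ _ _ "(*)"] cong)
       (simp_all only: iff Int_iff)
qed

section \<open>Three vertices on the cycle\<close>

text \<open>
  The vertices are met in the order \<open>u\<close>, \<open>v\<close>, \<open>w\<close> when the indices increase modulo \<open>n\<close>.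
\<close>

definition cyclic_order :: "nat \<Rightarrow> nat \<Rightarrow> nat \<Rightarrow> bool" where
  "cyclic_order u v w \<longleftrightarrow> u < v \<and> v < w \<or> v < w \<and> w < u \<or> w < u \<and> u < v"

lemma cyclic_order_rotate: "cyclic_order u v w \<Longrightarrow> cyclic_order v w u"
  unfolding cyclic_order_def by blast

lemma cyclic_order_total:
  "u \<noteq> v \<Longrightarrow> v \<noteq> w \<Longrightarrow> u \<noteq> w \<Longrightarrow> cyclic_order u v w \<or> cyclic_order w v u"
  unfolding cyclic_order_def by linarith

lemma arc_edges_three:
  assumes cyc: "cyclic_order u v w"
    and lt: "u < n" "v < n" "w < n"
  shows "arc_edges n v u = arc_edges n v w \<union> arc_edges n w u"
    and "arc_edges n u v \<union> arc_edges n v w \<union> arc_edges n w u = {0..<n}"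
    and "arc_edges n u v \<inter> arc_edges n v w = {}"
proof -
  have mem: "i \<in> arc_edges n x y \<longleftrightarrow> i < n \<and> (x \<le> i \<and> i < y \<or> y < x \<and> (x \<le> i \<or> i < y))" for i x y
    by (auto simp: arc_edges_def)
  have uv: "i \<in> arc_edges n v u \<longleftrightarrow> i \<in> arc_edges n v w \<or> i \<in> arc_edges n w u" for i
    using cyc lt unfolding mem cyclic_order_def by linarith
  then show "arc_edges n v u = arc_edges n v w \<union> arc_edges n w u" by blast
  have "i \<in> arc_edges n u v \<or> i \<in> arc_edges n v u \<longleftrightarrow> i < n" for i
    using cyc lt unfolding mem cyclic_order_def by linarith
  then have "i \<in> arc_edges n u v \<or> i \<in> arc_edges n v w \<or> i \<in> arc_edges n w u \<longleftrightarrow> i < n" for i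
    using uv by blast
  then show "arc_edges n u v \<union> arc_edges n v w \<union> arc_edges n w u = {0..<n}"
    by (simp add: set_eq_iff)
  have "\<not> (i \<in> arc_edges n u v \<and> i \<in> arc_edges n v w)" for i
    using cyc lt unfolding mem cyclic_order_def by linarith
  then show "arc_edges n u v \<inter> arc_edges n v w = {}" by blast
qed

lemma arc_edges_nonempty: "u < n \<Longrightarrow> v < n \<Longrightarrow> u \<noteq> v \<Longrightarrow> arc_edges n u v \<noteq> {}"
  using arc_edges_step(1) by blast

lemma card_arc_edges:
  assumes "u < n" "v < n"
  shows "card (arc_edges n u v) = (if u \<le> v then v - u else n - u + v)"
proof -
  have "arc_edges n u v = (if u \<le> v then {u..<v} else {u..<n} \<union> {0..<v})"
    using assms by (auto simp: arc_edges_def)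
  then show ?thesis by (simp add: card_Un_disjoint)
qed

lemma uadjacent_commute: "uadjacent G u v \<longleftrightarrow> uadjacent G v u"
  by (simp add: uadjacent_def insert_commute)

text \<open>
  The third vertex \<open>w\<close> lies on the arc from \<open>v\<close> back to \<open>u\<close>, which therefore has at least two edges.
  So only the arc from \<open>u\<close> to \<open>v\<close> can be a single edge joining them.
\<close>

lemma uadjacent_cycle_iff_card_arc:
  assumes cyc: "cyclic_order u v w" and lt: "u < n" "v < n" "w < n"
  shows "uadjacent (cycle_graph n) u v \<longleftrightarrow> card (arc_edges n u v) = 1"
proof -
  have "uadjacent (cycle_graph n) u v \<longleftrightarrow> v = (u + 1) mod n \<or> u = (v + 1) mod n"
    using lt by (auto simp: uadjacent_def cycle_graph_def doubleton_eq_iff image_iff)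
  also have "\<dots> \<longleftrightarrow> v = (if u + 1 = n then 0 else u + 1)"
    unfolding succ_mod[OF lt(1)] succ_mod[OF lt(2)]
    using cyc lt unfolding cyclic_order_def by auto
  also have "\<dots> \<longleftrightarrow> card (arc_edges n u v) = 1"
    unfolding card_arc_edges[OF lt(1,2)]
    using cyc lt unfolding cyclic_order_def by auto
  finally show ?thesis .
qed

theorem theorem5p1:
  fixes n a s b :: nat
  assumes "n \<ge> 3"
    and "a \<in> uverts (cycle_graph n)" "s \<in> uverts (cycle_graph n)" "b \<in> uverts (cycle_graph n)"
    and "a \<noteq> s" "s \<noteq> b" "a \<noteq> b"
  shows "event_covariance (random_orientation (cycle_graph n))
           (path_event (cycle_graph n) a s) (path_event (cycle_graph n) s b) \<le> - ((1/2) ^ (2 * n))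
     \<and> (event_covariance (random_orientation (cycle_graph n))
           (path_event (cycle_graph n) a s) (path_event (cycle_graph n) s b) = - ((1/2) ^ (2 * n))
         \<longleftrightarrow> uadjacent (cycle_graph n) a s \<and> uadjacent (cycle_graph n) b s)"
proof -
  have lt: "a < n" "s < n" "b < n" using assms by (auto simp: cycle_graph_def)
  have ne: "arc_edges n u v \<noteq> {}" if "u \<noteq> v" "u < n" "v < n" for u v
    using that by (intro arc_edges_nonempty)
  consider (asb) "cyclic_order a s b" | (bsa) "cyclic_order b s a"
    using cyclic_order_total assms(5-7) by blast
  then show ?thesis
  proof cases
    case asb
    note sba = cyclic_order_rotate[OF asb] and bas = cyclic_order_rotate[OF cyclic_order_rotate[OF asb]]
    let ?X = "arc_edges n a s" and ?Y = "arc_edges n b a" and ?Z = "arc_edges n s b"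
    note arcs = arc_edges_three[OF asb lt(1,2,3)] arc_edges_three[OF sba lt(2,3,1)]
      arc_edges_three[OF bas lt(3,1,2)]
    have "?X \<union> ?Y \<union> ?Z = {0..<n}" "?X \<inter> ?Y = {}" "?X \<inter> ?Z = {}" "?Y \<inter> ?Z = {}"
      using arcs(2,3,6,9) by blast+
    moreover have "?X \<noteq> {}" "?Y \<noteq> {}" "?Z \<noteq> {}"
      using ne lt assms(5-7) by auto
    moreover have "arc_edges n s a = ?Y \<union> ?Z" "arc_edges n b s = ?X \<union> ?Y"
      using arcs(1,4) by blast+
    moreover have "uadjacent (cycle_graph n) a s \<longleftrightarrow> card ?X = 1"
      by (rule uadjacent_cycle_iff_card_arc[OF asb lt(1,2,3)])
    moreover have "uadjacent (cycle_graph n) b s \<longleftrightarrow> card ?Z = 1"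
      unfolding uadjacent_commute[of _ b] by (rule uadjacent_cycle_iff_card_arc[OF sba lt(2,3,1)])
    ultimately show ?thesis
      using covariance_arc_events[OF assms(1), of ?X ?Y ?Z True]
      by (simp add: covariance_path_events[OF assms(1) lt(1,2,2,3)])
  next
    case bsa
    \<comment> \<open>Here the way from \<open>a\<close> through \<open>s\<close> to \<open>b\<close> runs against the numbering, so the flag is \<open>False\<close>.\<close>
    note sab = cyclic_order_rotate[OF bsa] and abs = cyclic_order_rotate[OF cyclic_order_rotate[OF bsa]]
    let ?X = "arc_edges n s a" and ?Y = "arc_edges n a b" and ?Z = "arc_edges n b s"
    note arcs = arc_edges_three[OF bsa lt(3,2,1)] arc_edges_three[OF sab lt(2,1,3)]
      arc_edges_three[OF abs lt(1,3,2)]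
    have "?X \<union> ?Y \<union> ?Z = {0..<n}" "?X \<inter> ?Y = {}" "?X \<inter> ?Z = {}" "?Y \<inter> ?Z = {}"
      using arcs(2,3,6,9) by blast+
    moreover have "?X \<noteq> {}" "?Y \<noteq> {}" "?Z \<noteq> {}"
      using ne lt assms(5-7) by auto
    moreover have "arc_edges n a s = ?Y \<union> ?Z" "arc_edges n s b = ?X \<union> ?Y"
      using arcs(1,4) by blast+
    moreover have "uadjacent (cycle_graph n) a s \<longleftrightarrow> card ?X = 1"
      unfolding uadjacent_commute[of _ a] by (rule uadjacent_cycle_iff_card_arc[OF sab lt(2,1,3)])
    moreover have "uadjacent (cycle_graph n) b s \<longleftrightarrow> card ?Z = 1"
      by (rule uadjacent_cycle_iff_card_arc[OF bsa lt(3,2,1)])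
    ultimately show ?thesis
      using covariance_arc_events[OF assms(1), of ?X ?Y ?Z False]
      by (simp add: covariance_path_events[OF assms(1) lt(1,2,2,3)] Un_commute)
  qed
qed

end
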